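(* (i) [Edge deletion, vertex deletion] If $G$ is any graph and $H$ is a spanning subgraph of $G$, then $\alpha_1(G)\le\alpha_1(H)$ and $\theta_1(G)\le\theta_1(H)$. If $H$ is any subgraph of $G$, then $\omega_1(G)\ge\omega_1(H)$ and $\chi_1(G)\ge\chi_1(H)$. (ii) [Vertex-disjoint union] If $G$ is disconnected and $G_1,\dots,G_k$ are its connected components, then $$\chi_1(G)=\max_{1\le i\le k}\chi_1(G_i),\quad \omega_1(G)=\max_{1\le i\le k}\omega_1(G_i),\quad \alpha_1(G)=\sum_{i=1}^k\alpha_1(G_i),\quad \theta_1(G)=\sum_{i=1}^k\theta_1(G_i).$$ (iii) [Union of two graphs] If $V(G_1)=V(G_2)$, then $$\chi_1(G_1\cup G_2)\le\min\{\chi(G_1)\,\chi_1(G_2),\ \chi_1(G_1)\,\chi(G_2)\},$$ and the bound is tight (attained with equality by some $G_1,G_2$). (iv) [General graph union] If $G_1,\dots,G_k$ are graphs on the same vertex set, then $$\chi_1(G_1\cup\cdots\cup G_k)\le(2k+1)\prod_{i=1}^k\chi_1(G_i).$$ Moreover, for every positive integer $k$ there exist graphs $G_1,\dots,G_k$ on the same vertex set such that $$\chi_1(G_1\cup\cdots\cup G_k)\ge\frac{2k+1}{3}\prod_{i=1}^k\chi_1(G_i).$$ (v) [Lexicographic product] For any two graphs $G$ and $H$, $\chi_1(G\circ H)\le\chi(G)\cdot\chi_1(H)$. (vi) [Line graph] The equality $\chi_1'(G)=\chi_1(L(G))$ does not hold in general, i.e. there exists a graph $G$ with $\chi_1'(G)\ne\chi_1(L(G))$,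 where $L(G)$ is the line graph of $G$.
   Context: All graphs are finite and simple. $\chi,\omega,\alpha,\theta,\chi'$ denote the chromatic number, clique number, independence number, clique covering number (minimum number of cliques partitioning the vertex set) and chromatic index. A 1-selection in a graph $G=(V,E)$ is a mapping $f:V\to E\cup\{\varnothing\}$, not necessarily injective, such that $v\in f(v)$ for every $v\in V$ with $f(v)\ne\varnothing$. The 1-removed subgraph $G_f$ has vertex set $V$ and edge set $E\setminus f(V)$. With minimum and maximum taken over all 1-selections $f$ on $G$: $\chi_1(G)=\min_f\chi(G_f)$, $\omega_1(G)=\min_f\omega(G_f)$, $\alpha_1(G)=\max_f\alpha(G_f)$, $\theta_1(G)=\max_f\theta(G_f)$, $\chi_1'(G)=\min_f\chi'(G_f)$. $G\cup H$ is the graph with vertex set $V(G)\cup V(H)$ and edge set $E(G)\cup E(H)$. The lexicographic product $G\circ H$ has vertex set $V(G)\times V(H)$, with $(g',h')$ and $(g'',h'')$ adjacent iff either $g'g''\in E(G)$, or $g'=g''$ and $h'h''\in E(H)$. *)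

theory Defs
  imports Complex_Main "HOL-Library.Disjoint_Sets"
begin

datatype 'a graph = Graph (verts: "'a set") (edges: "'a set set")

text \<open>The graph without vertices is permitted.\<close>

definition simple_graph :: "'a graph \<Rightarrow> bool" where
  "simple_graph G \<longleftrightarrow> finite (verts G) \<and> (\<forall>e\<in>edges G. e \<subseteq> verts G \<and> card e = 2)"

definition adjacent :: "'a graph \<Rightarrow> 'a \<Rightarrow> 'a \<Rightarrow> bool" where
  "adjacent G u v \<longleftrightarrow> {u, v} \<in> edges G"

definition subgraph :: "'a graph \<Rightarrow> 'a graph \<Rightarrow> bool" where
  "subgraph H G \<longleftrightarrow> verts H \<subseteq> verts G \<and> edges H \<subseteq> edges G"

definition spanning_subgraph :: "'a graph \<Rightarrow> 'a graph \<Rightarrow> bool" where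
  "spanning_subgraph H G \<longleftrightarrow> subgraph H G \<and> verts H = verts G"

definition induced_subgraph :: "'a graph \<Rightarrow> 'a set \<Rightarrow> 'a graph" where
  "induced_subgraph G S = Graph S {e \<in> edges G. e \<subseteq> S}"

definition reachable :: "'a graph \<Rightarrow> 'a \<Rightarrow> 'a \<Rightarrow> bool" where
  "reachable G = (adjacent G)\<^sup>*\<^sup>*"

text \<open>The graph without vertices counts as connected, so that a disconnected graph has at
  least two components.\<close>

definition connected_graph :: "'a graph \<Rightarrow> bool" where
  "connected_graph G \<longleftrightarrow> (\<forall>u\<in>verts G. \<forall>v\<in>verts G. reachable G u v)"

definition components :: "'a graph \<Rightarrow> 'a graph set" where
  "components G = (\<lambda>v. induced_subgraph G {u \<in> verts G. reachable G v u}) ` verts G"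

definition proper_colouring :: "'a graph \<Rightarrow> nat \<Rightarrow> ('a \<Rightarrow> nat) \<Rightarrow> bool" where
  "proper_colouring G k c \<longleftrightarrow> (\<forall>v\<in>verts G. c v < k) \<and>
     (\<forall>u\<in>verts G. \<forall>v\<in>verts G. adjacent G u v \<longrightarrow> c u \<noteq> c v)"

definition chromatic_number :: "'a graph \<Rightarrow> nat" where
  "chromatic_number G = (LEAST k. \<exists>c. proper_colouring G k c)"

definition clique :: "'a graph \<Rightarrow> 'a set \<Rightarrow> bool" where
  "clique G K \<longleftrightarrow> K \<subseteq> verts G \<and> (\<forall>u\<in>K. \<forall>v\<in>K. u \<noteq> v \<longrightarrow> adjacent G u v)"

definition clique_number :: "'a graph \<Rightarrow> nat" where
  "clique_number G = Max {card K |K. clique G K}"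

definition independent :: "'a graph \<Rightarrow> 'a set \<Rightarrow> bool" where
  "independent G S \<longleftrightarrow> S \<subseteq> verts G \<and> (\<forall>u\<in>S. \<forall>v\<in>S. \<not> adjacent G u v)"

definition independence_number :: "'a graph \<Rightarrow> nat" where
  "independence_number G = Max {card S |S. independent G S}"

definition clique_cover_number :: "'a graph \<Rightarrow> nat" where
  "clique_cover_number G =
     (LEAST k. \<exists>P. partition_on (verts G) P \<and> (\<forall>K\<in>P. clique G K) \<and> card P = k)"

definition proper_edge_colouring :: "'a graph \<Rightarrow> nat \<Rightarrow> ('a set \<Rightarrow> nat) \<Rightarrow> bool" where
  "proper_edge_colouring G k c \<longleftrightarrow> (\<forall>e\<in>edges G. c e < k) \<and>
     (\<forall>d\<in>edges G. \<forall>e\<in>edges G. d \<noteq> e \<and> d \<inter> e \<noteq> {} \<longrightarrow> c d \<noteq> c e)"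

definition chromatic_index :: "'a graph \<Rightarrow> nat" where
  "chromatic_index G = (LEAST k. \<exists>c. proper_edge_colouring G k c)"

text \<open>A selection is a total function, of which only the values on \<^term>\<open>verts G\<close> matter;
  \<^term>\<open>f v = {}\<close> means that nothing is selected at \<^term>\<open>v\<close>.\<close>

definition one_selection :: "'a graph \<Rightarrow> ('a \<Rightarrow> 'a set) \<Rightarrow> bool" where
  "one_selection G f \<longleftrightarrow> (\<forall>v\<in>verts G. f v \<in> edges G \<union> {{}} \<and> (f v \<noteq> {} \<longrightarrow> v \<in> f v))"

definition one_removed :: "'a graph \<Rightarrow> ('a \<Rightarrow> 'a set) \<Rightarrow> 'a graph" where
  "one_removed G f = Graph (verts G) (edges G - f ` verts G)"

definition chi1 :: "'a graph \<Rightarrow> nat" where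
  "chi1 G = Min {chromatic_number (one_removed G f) |f. one_selection G f}"

definition omega1 :: "'a graph \<Rightarrow> nat" where
  "omega1 G = Min {clique_number (one_removed G f) |f. one_selection G f}"

definition alpha1 :: "'a graph \<Rightarrow> nat" where
  "alpha1 G = Max {independence_number (one_removed G f) |f. one_selection G f}"

definition theta1 :: "'a graph \<Rightarrow> nat" where
  "theta1 G = Max {clique_cover_number (one_removed G f) |f. one_selection G f}"

definition chi_index1 :: "'a graph \<Rightarrow> nat" where
  "chi_index1 G = Min {chromatic_index (one_removed G f) |f. one_selection G f}"

definition graph_union :: "'a graph \<Rightarrow> 'a graph \<Rightarrow> 'a graph" where
  "graph_union G H = Graph (verts G \<union> verts H) (edges G \<union> edges H)"

definition graph_Union :: "'i set \<Rightarrow> ('i \<Rightarrow> 'a graph) \<Rightarrow> 'a graph" where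
  "graph_Union I G = Graph (\<Union>i\<in>I. verts (G i)) (\<Union>i\<in>I. edges (G i))"

definition lex_product :: "'a graph \<Rightarrow> 'b graph \<Rightarrow> ('a \<times> 'b) graph" where
  "lex_product G H = Graph (verts G \<times> verts H)
     {{(g, h), (g', h')} |g h g' h'. g \<in> verts G \<and> g' \<in> verts G \<and> h \<in> verts H \<and> h' \<in> verts H \<and>
        (adjacent G g g' \<or> g = g' \<and> adjacent H h h')}"

definition line_graph :: "'a graph \<Rightarrow> 'a set graph" where
  "line_graph G = Graph (edges G)
     {{d, e} |d e. d \<in> edges G \<and> e \<in> edges G \<and> d \<noteq> e \<and> d \<inter> e \<noteq> {}}"

end

theory Submission
  imports Defs
begin

text \<open>In (ii) the components of \<open>G\<close> must also serve as parts of
  \<open>one_removed G f\<close>, where they may fall apart. The invariants are therefore computed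
  over any division of the vertices without crossing edges, connected or not. In (iv) the
  \<open>k\<close> selections cannot be imposed on the union together, since a vertex may select
  only one edge, not one in each of \<open>k\<close> graphs. The upper bound therefore removes
  nothing and bounds the chromatic number of the whole union, the selected edges receiving a
  colouring of their own. Each selected edge inside \<open>S\<close> is chosen by a pair of a graph
  and a vertex of \<open>S\<close>, which is the origin of \<open>k * card S\<close>; so every
  induced subgraph has average degree at most \<open>2 * k\<close>. For the lower bound, the nonzero
  residues modulo \<open>2 * k + 1\<close> are, up to sign, exactly \<open>1\<close>, ...,
  \<open>k\<close>, and a circulant with a single step has as many edges as vertices, so one
  selection takes them all. The bound 3 is the largest \<open>s\<close> with
  \<open>s * (s - 1) / 2 \<le> s\<close>.\<close>

text \<open>Selections restrict to subgraphs and, since a selected edge lies inside a single component,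
  glue uniquely from the components; this gives (i) and (ii). The bounds (iii) and (v) come from
  product colourings. For (iv), the edges removed by optimal selections of the \<open>k\<close> graphs form a
  graph in which every vertex set \<open>S\<close> spans at most \<open>k * card S\<close> edges; it is therefore
  \<open>2 * k\<close>-degenerate and costs a factor \<open>2 * k + 1\<close>. Conversely, the complete graph on
  \<open>2 * k + 1\<close> vertices is a union of \<open>k\<close> circulant graphs with \<open>chi1 = 1\<close>, while a selection
  can empty only vertex sets with at most three elements.\<close>

section \<open>Attaining the optima\<close>

lemma finite_verts: "simple_graph G \<Longrightarrow> finite (verts G)"
  by (simp add: simple_graph_def)

lemma edge_subset_verts: "simple_graph G \<Longrightarrow> e \<in> edges G \<Longrightarrow> e \<subseteq> verts G"
  by (simp add: simple_graph_def)

lemma card_edge: "simple_graph G \<Longrightarrow> e \<in> edges G \<Longrightarrow> card e = 2"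
  by (simp add: simple_graph_def)

lemma finite_edges:
  assumes "simple_graph G" shows "finite (edges G)"
  using assms by (intro finite_subset[of "edges G" "Pow (verts G)"]) (auto simp: simple_graph_def)

lemma adjacent_commute: "adjacent G u v \<longleftrightarrow> adjacent G v u"
  by (simp add: adjacent_def insert_commute)

lemma adjacent_irrefl: "simple_graph G \<Longrightarrow> \<not> adjacent G v v"
  using card_edge[of G "{v}"] by (auto simp: adjacent_def)

lemma adjacent_verts: "simple_graph G \<Longrightarrow> adjacent G u v \<Longrightarrow> u \<in> verts G \<and> v \<in> verts G"
  using edge_subset_verts by (fastforce simp: adjacent_def)

lemma edge_adjacentE:
  assumes "simple_graph G" "e \<in> edges G"
  obtains u v where "e = {u, v}" "u \<noteq> v" "adjacent G u v"
  using card_edge[OF assms] assms(2) by (auto simp: card_2_iff adjacent_def)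

section \<open>Removed subgraphs and optimal selections\<close>

lemma verts_one_removed [simp]: "verts (one_removed G f) = verts G"
  by (simp add: one_removed_def)

lemma edges_one_removed [simp]: "edges (one_removed G f) = edges G - f ` verts G"
  by (simp add: one_removed_def)

lemma simple_graph_one_removed: "simple_graph G \<Longrightarrow> simple_graph (one_removed G f)"
  by (simp add: simple_graph_def)

text \<open>There may be infinitely many selections, being total functions on a type that may be
  infinite. But the removed subgraph is determined by its edge set, one of finitely many subsets of
  \<open>edges G\<close>; so every \<open>Min\<close> and \<open>Max\<close> over selections is
  taken over a finite set.\<close>

lemma finite_one_removed:
  assumes "simple_graph G"
  shows "finite {q (one_removed G f) |f. one_selection G f}"
proof (rule finite_subset)
  show "{q (one_removed G f) |f. one_selection G f} \<subseteq> (q \<circ> Graph (verts G)) ` Pow (edges G)"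
    by (auto simp: one_removed_def)
  show "finite ((q \<circ> Graph (verts G)) ` Pow (edges G))"
    using finite_edges[OF assms] by simp
qed

lemma one_selection_empty: "one_selection G (\<lambda>_. {})"
  by (simp add: one_selection_def)

lemma one_removed_nonempty: "{q (one_removed G f) |f. one_selection G f} \<noteq> {}"
  using one_selection_empty by blast

lemma Min_one_removed_attained:
  assumes "simple_graph G"
  obtains f where "one_selection G f"
    "Min {q (one_removed G f) |f. one_selection G f} = (q (one_removed G f) :: nat)"
  using Min_in[OF finite_one_removed[OF assms] one_removed_nonempty, of q] by blast

lemma Max_one_removed_attained:
  assumes "simple_graph G"
  obtains f where "one_selection G f"
    "Max {q (one_removed G f) |f. one_selection G f} = (q (one_removed G f) :: nat)"
  using Max_in[OF finite_one_removed[OF assms] one_removed_nonempty, of q] by blast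

lemma chi1_le: "simple_graph G \<Longrightarrow> one_selection G f \<Longrightarrow> chi1 G \<le> chromatic_number (one_removed G f)"
  unfolding chi1_def by (rule Min_le[OF finite_one_removed]) auto

lemma omega1_le: "simple_graph G \<Longrightarrow> one_selection G f \<Longrightarrow> omega1 G \<le> clique_number (one_removed G f)"
  unfolding omega1_def by (rule Min_le[OF finite_one_removed]) auto

lemma alpha1_ge: "simple_graph G \<Longrightarrow> one_selection G f \<Longrightarrow> independence_number (one_removed G f) \<le> alpha1 G"
  unfolding alpha1_def by (rule Max_ge[OF finite_one_removed]) auto

lemma theta1_ge: "simple_graph G \<Longrightarrow> one_selection G f \<Longrightarrow> clique_cover_number (one_removed G f) \<le> theta1 G"
  unfolding theta1_def by (rule Max_ge[OF finite_one_removed]) auto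

lemma chi1_attained:
  assumes "simple_graph G"
  obtains f where "one_selection G f" "chi1 G = chromatic_number (one_removed G f)"
  using Min_one_removed_attained[OF assms, of chromatic_number] unfolding chi1_def by blast

lemma omega1_attained:
  assumes "simple_graph G"
  obtains f where "one_selection G f" "omega1 G = clique_number (one_removed G f)"
  using Min_one_removed_attained[OF assms, of clique_number] unfolding omega1_def by blast

lemma alpha1_attained:
  assumes "simple_graph G"
  obtains f where "one_selection G f" "alpha1 G = independence_number (one_removed G f)"
  using Max_one_removed_attained[OF assms, of independence_number] unfolding alpha1_def by blast

lemma theta1_attained:
  assumes "simple_graph G"
  obtains f where "one_selection G f" "theta1 G = clique_cover_number (one_removed G f)"
  using Max_one_removed_attained[OF assms, of clique_cover_number] unfolding theta1_def by blast

section \<open>Witnesses for the invariants of a single graph\<close>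

lemma chromatic_number_le: "proper_colouring G k c \<Longrightarrow> chromatic_number G \<le> k"
  unfolding chromatic_number_def by (rule Least_le) blast

text \<open>Renumbering the colours allows any finite set of them; the product colourings below use
  pairs and tuples as colours.\<close>

lemma chromatic_number_le_card:
  assumes "finite A" and "\<And>v. v \<in> verts G \<Longrightarrow> c v \<in> A"
    and "\<And>u v. u \<in> verts G \<Longrightarrow> v \<in> verts G \<Longrightarrow> adjacent G u v \<Longrightarrow> c u \<noteq> c v"
  shows "chromatic_number G \<le> card A"
proof -
  obtain h where h: "bij_betw h A {0..<card A}"
    using ex_bij_betw_finite_nat[OF assms(1)] by blast
  then have "h a < card A" if "a \<in> A" for a
    using that by (auto simp: bij_betw_def)
  moreover have "h a \<noteq> h b" if "a \<in> A" "b \<in> A" "a \<noteq> b" for a b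
    using that h by (auto simp: bij_betw_def inj_on_def)
  ultimately have "proper_colouring G (card A) (h \<circ> c)"
    unfolding proper_colouring_def using assms(2,3) by simp
  then show ?thesis
    by (rule chromatic_number_le)
qed

lemma chromatic_number_colouring:
  assumes "simple_graph G"
  obtains c where "\<And>v. v \<in> verts G \<Longrightarrow> c v < chromatic_number G"
    and "\<And>u v. adjacent G u v \<Longrightarrow> c u \<noteq> c v"
proof -
  \<comment> \<open>Giving all vertices different colours shows that the \<open>LEAST\<close> in the
    definition ranges over a nonempty set.\<close>
  obtain h where "bij_betw h (verts G) {0..<card (verts G)}"
    using ex_bij_betw_finite_nat[OF finite_verts[OF assms]] by blast
  then have "proper_colouring G (card (verts G)) h"
    using adjacent_irrefl[OF assms]
    by (fastforce simp: proper_colouring_def bij_betw_def inj_on_def)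
  then have "\<exists>k c. proper_colouring G k c"
    by blast
  from LeastI_ex[OF this] obtain c where "proper_colouring G (chromatic_number G) c"
    unfolding chromatic_number_def by blast
  then show thesis
    using that[of c] adjacent_verts[OF assms] by (auto simp: proper_colouring_def)
qed

lemma finite_subset_cards:
  assumes "finite V" "\<And>K. P K \<Longrightarrow> K \<subseteq> V"
  shows "finite {card K |K. P K}"
  by (rule finite_subset[of _ "card ` Pow V"]) (use assms in auto)

lemma finite_cliques: "simple_graph G \<Longrightarrow> finite {card K |K. clique G K}"
  by (rule finite_subset_cards[of "verts G"]) (auto simp: finite_verts clique_def)

lemma finite_independents: "simple_graph G \<Longrightarrow> finite {card K |K. independent G K}"
  by (rule finite_subset_cards[of "verts G"]) (auto simp: finite_verts independent_def)

lemma clique_number_ge: "simple_graph G \<Longrightarrow> clique G K \<Longrightarrow> card K \<le> clique_number G"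
  unfolding clique_number_def by (rule Max_ge[OF finite_cliques]) auto

lemma clique_number_attained:
  assumes "simple_graph G" obtains K where "clique G K" "card K = clique_number G"
proof -
  have "clique G {}" by (simp add: clique_def)
  then have "{card K |K. clique G K} \<noteq> {}"
    by blast
  from Max_in[OF finite_cliques[OF assms] this] show thesis
    using that unfolding clique_number_def by force
qed

lemma independence_number_ge: "simple_graph G \<Longrightarrow> independent G K \<Longrightarrow> card K \<le> independence_number G"
  unfolding independence_number_def by (rule Max_ge[OF finite_independents]) auto

lemma independence_number_attained:
  assumes "simple_graph G" obtains K where "independent G K" "card K = independence_number G"
proof -
  have "independent G {}" by (simp add: independent_def)
  then have "{card K |K. independent G K} \<noteq> {}"
    by blast
  from Max_in[OF finite_independents[OF assms] this] show thesis
    using that unfolding independence_number_def by force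
qed

lemma clique_cover_number_le:
  "partition_on (verts G) P \<Longrightarrow> (\<And>K. K \<in> P \<Longrightarrow> clique G K) \<Longrightarrow> clique_cover_number G \<le> card P"
  unfolding clique_cover_number_def by (rule Least_le) blast

lemma clique_cover_attained:
  obtains P where "partition_on (verts G) P" "\<And>K. K \<in> P \<Longrightarrow> clique G K" "card P = clique_cover_number G"
proof -
  \<comment> \<open>Singletons are cliques, so some clique partition exists and the
    \<open>LEAST\<close> is attained.\<close>
  have "partition_on (verts G) ((\<lambda>v. {v}) ` verts G)" "\<forall>K\<in>(\<lambda>v. {v}) ` verts G. clique G K"
    by (auto simp: partition_on_def disjoint_def clique_def)
  then have "\<exists>k P. partition_on (verts G) P \<and> (\<forall>K\<in>P. clique G K) \<and> card P = k"
    by blast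
  from LeastI_ex[OF this] show thesis
    using that unfolding clique_cover_number_def by blast
qed

section \<open>Subgraphs\<close>

lemma adjacent_subgraph: "subgraph H G \<Longrightarrow> adjacent H u v \<Longrightarrow> adjacent G u v"
  by (auto simp: subgraph_def adjacent_def)

lemma chromatic_number_mono:
  assumes "simple_graph G" "subgraph H G"
  shows "chromatic_number H \<le> chromatic_number G"
proof -
  obtain c where "\<And>v. v \<in> verts G \<Longrightarrow> c v < chromatic_number G"
    and "\<And>u v. adjacent G u v \<Longrightarrow> c u \<noteq> c v"
    using chromatic_number_colouring[OF assms(1)] by blast
  then have "proper_colouring H (chromatic_number G) c"
    using assms(2) adjacent_subgraph[OF assms(2)] by (auto simp: proper_colouring_def subgraph_def)
  then show ?thesis
    by (rule chromatic_number_le)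
qed

lemma clique_number_mono:
  assumes "simple_graph G" "simple_graph H" "subgraph H G"
  shows "clique_number H \<le> clique_number G"
proof -
  obtain K where "clique H K" and K: "card K = clique_number H"
    using clique_number_attained[OF assms(2)] .
  then have "clique G K"
    using assms(3) adjacent_subgraph[OF assms(3)] by (auto simp: clique_def subgraph_def)
  then show ?thesis
    using clique_number_ge[OF assms(1)] K by metis
qed

text \<open>Losing edges keeps a set independent, while losing vertices could destroy it; hence the
  restriction to spanning subgraphs.\<close>

lemma independence_number_antimono:
  assumes "simple_graph G" "simple_graph H" "spanning_subgraph H G"
  shows "independence_number G \<le> independence_number H"
proof -
  obtain K where "independent G K" and K: "card K = independence_number G"
    using independence_number_attained[OF assms(1)] .
  then have "independent H K"
    using assms(3) adjacent_subgraph unfolding independent_def spanning_subgraph_def by metis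
  then show ?thesis
    using independence_number_ge[OF assms(2)] K by metis
qed

lemma clique_cover_number_antimono:
  assumes "spanning_subgraph H G"
  shows "clique_cover_number G \<le> clique_cover_number H"
proof -
  obtain P where P: "partition_on (verts H) P" "\<And>K. K \<in> P \<Longrightarrow> clique H K"
    "card P = clique_cover_number H"
    using clique_cover_attained by blast
  have "clique G K" if "K \<in> P" for K
    using P(2)[OF that] assms adjacent_subgraph[of H G] by (auto simp: clique_def spanning_subgraph_def)
  then show ?thesis
    using clique_cover_number_le[of G P] P(1,3) assms by (simp add: spanning_subgraph_def)
qed

text \<open>Selected edges outside \<open>H\<close> are replaced by the empty choice. Nothing that
  \<open>f\<close> removed from \<open>H\<close> survives, because a vertex selecting an edge of
  \<open>H\<close> lies on that edge and hence in \<open>H\<close>. All four monotonicity results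
  rest on this.\<close>

lemma one_selection_restrict:
  assumes "simple_graph G" "simple_graph H" "subgraph H G" "one_selection G f"
  obtains g where "one_selection H g" "subgraph (one_removed H g) (one_removed G f)"
proof
  let ?g = "\<lambda>v. if f v \<in> edges H then f v else {}"
  show "one_selection H ?g"
    using assms(3,4) by (auto simp: one_selection_def subgraph_def)
  have "e \<notin> f ` verts G" if e: "e \<in> edges H" "e \<notin> ?g ` verts H" for e
  proof
    assume "e \<in> f ` verts G"
    then obtain v where v: "v \<in> verts G" "e = f v" by blast
    with e card_edge[OF assms(2) e(1)] have "v \<in> e"
      using assms(4) by (auto simp: one_selection_def)
    with edge_subset_verts[OF assms(2) e(1)] v e show False by auto
  qed
  then show "subgraph (one_removed H ?g) (one_removed G f)"
    using assms(3) by (auto simp: subgraph_def)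
qed

lemma chi1_mono:
  assumes "simple_graph G" "simple_graph H" "subgraph H G"
  shows "chi1 H \<le> chi1 G"
proof -
  obtain f where f: "one_selection G f" "chi1 G = chromatic_number (one_removed G f)"
    using chi1_attained[OF assms(1)] .
  obtain g where "one_selection H g" "subgraph (one_removed H g) (one_removed G f)"
    using one_selection_restrict[OF assms f(1)] .
  then show ?thesis
    using chi1_le[OF assms(2)] chromatic_number_mono[OF simple_graph_one_removed[OF assms(1)]] f(2)
    by (metis order_trans)
qed

lemma omega1_mono:
  assumes "simple_graph G" "simple_graph H" "subgraph H G"
  shows "omega1 H \<le> omega1 G"
proof -
  obtain f where f: "one_selection G f" "omega1 G = clique_number (one_removed G f)"
    using omega1_attained[OF assms(1)] .
  obtain g where "one_selection H g" "subgraph (one_removed H g) (one_removed G f)"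
    using one_selection_restrict[OF assms f(1)] .
  then show ?thesis
    using omega1_le[OF assms(2)] f(2) clique_number_mono[OF simple_graph_one_removed[OF assms(1)]
        simple_graph_one_removed[OF assms(2)]]
    by (metis order_trans)
qed

lemma alpha1_antimono:
  assumes "simple_graph G" "simple_graph H" "spanning_subgraph H G"
  shows "alpha1 G \<le> alpha1 H"
proof -
  obtain f where f: "one_selection G f" "alpha1 G = independence_number (one_removed G f)"
    using alpha1_attained[OF assms(1)] .
  have sub: "subgraph H G"
    using assms(3) by (simp add: spanning_subgraph_def)
  obtain g where g: "one_selection H g" "subgraph (one_removed H g) (one_removed G f)"
    using one_selection_restrict[OF assms(1,2) sub f(1)] .
  then have "spanning_subgraph (one_removed H g) (one_removed G f)"
    using assms(3) by (simp add: spanning_subgraph_def)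
  then show ?thesis
    using alpha1_ge[OF assms(2) g(1)] f(2)
      independence_number_antimono[OF simple_graph_one_removed[OF assms(1)]
        simple_graph_one_removed[OF assms(2)]]
    by (metis order_trans)
qed

lemma theta1_antimono:
  assumes "simple_graph G" "simple_graph H" "spanning_subgraph H G"
  shows "theta1 G \<le> theta1 H"
proof -
  obtain f where f: "one_selection G f" "theta1 G = clique_cover_number (one_removed G f)"
    using theta1_attained[OF assms(1)] .
  have sub: "subgraph H G"
    using assms(3) by (simp add: spanning_subgraph_def)
  obtain g where g: "one_selection H g" "subgraph (one_removed H g) (one_removed G f)"
    using one_selection_restrict[OF assms(1,2) sub f(1)] .
  then have "spanning_subgraph (one_removed H g) (one_removed G f)"
    using assms(3) by (simp add: spanning_subgraph_def)
  then show ?thesis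
    using theta1_ge[OF assms(2) g(1)] f(2) clique_cover_number_antimono by (metis order_trans)
qed

section \<open>Connected components\<close>

lemma verts_induced [simp]: "verts (induced_subgraph G S) = S"
  by (simp add: induced_subgraph_def)

lemma edges_induced [simp]: "edges (induced_subgraph G S) = {e \<in> edges G. e \<subseteq> S}"
  by (simp add: induced_subgraph_def)

lemma adjacent_induced: "adjacent (induced_subgraph G S) u v \<longleftrightarrow> adjacent G u v \<and> u \<in> S \<and> v \<in> S"
  by (auto simp: adjacent_def)

lemma simple_graph_induced: "simple_graph G \<Longrightarrow> S \<subseteq> verts G \<Longrightarrow> simple_graph (induced_subgraph G S)"
  by (auto simp: simple_graph_def intro: finite_subset)

text \<open>The parts need not be connected. This allows the components of \<open>G\<close> to be
  used for \<open>one_removed G f\<close> too, whose own components may be smaller.\<close>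

locale split_graph =
  fixes H :: "'a graph" and I :: "'i set" and V :: "'i \<Rightarrow> 'a set"
  assumes simple: "simple_graph H"
    and finite_index: "finite I"
    and disjoint: "disjoint_family_on V I"
    and verts: "verts H = (\<Union>i\<in>I. V i)"
    and edge_part: "\<And>e. e \<in> edges H \<Longrightarrow> \<exists>i\<in>I. e \<subseteq> V i"
begin

abbreviation part :: "'i \<Rightarrow> 'a graph" where
  "part i \<equiv> induced_subgraph H (V i)"

lemma part_subset: "i \<in> I \<Longrightarrow> V i \<subseteq> verts H"
  using verts by blast

lemma simple_part: "i \<in> I \<Longrightarrow> simple_graph (part i)"
  by (rule simple_graph_induced[OF simple part_subset])

lemma part_unique: "i \<in> I \<Longrightarrow> j \<in> I \<Longrightarrow> v \<in> V i \<Longrightarrow> v \<in> V j \<Longrightarrow> i = j"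
  using disjoint by (auto simp: disjoint_family_on_def)

lemma adjacent_same_part: "adjacent H u v \<Longrightarrow> i \<in> I \<Longrightarrow> u \<in> V i \<Longrightarrow> v \<in> V i"
  using edge_part[of "{u, v}"] part_unique by (fastforce simp: adjacent_def)

text \<open>One vertex of the clique fixes the part, and adjacency keeps all the others in it. The
  empty clique is excluded because there may be no part at all.\<close>

lemma clique_in_part:
  assumes "clique H K" "K \<noteq> {}"
  obtains i where "i \<in> I" "K \<subseteq> V i"
proof -
  obtain u i where u: "u \<in> K" and i: "i \<in> I" "u \<in> V i"
    using assms verts unfolding clique_def by (metis UN_E ex_in_conv subsetD)
  have "K \<subseteq> V i"
    using assms(1) u i adjacent_same_part[of u _ i] by (fastforce simp: clique_def)
  then show thesis using that i by blast
qed

text \<open>No edge crosses between parts, so all of them may reuse the same colours. An arbitrary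
  bound \<open>m\<close> in place of a maximum avoids the case of an empty index set; the reverse
  inequality for \<open>chi1\<close> will come from monotonicity.\<close>

lemma chromatic_number_le_parts:
  assumes "\<And>i. i \<in> I \<Longrightarrow> chromatic_number (part i) \<le> m"
  shows "chromatic_number H \<le> m"
proof -
  have "\<exists>c. (\<forall>v\<in>V i. c v < chromatic_number (part i)) \<and> (\<forall>u v. adjacent (part i) u v \<longrightarrow> c u \<noteq> c v)"
    if "i \<in> I" for i
    using chromatic_number_colouring[OF simple_part[OF that]] by (metis verts_induced)
  then obtain c where c: "\<And>i v. i \<in> I \<Longrightarrow> v \<in> V i \<Longrightarrow> c i v < chromatic_number (part i)"
    "\<And>i u v. i \<in> I \<Longrightarrow> adjacent (part i) u v \<Longrightarrow> c i u \<noteq> c i v"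
    by metis
  obtain p where p: "\<And>v. v \<in> verts H \<Longrightarrow> p v \<in> I \<and> v \<in> V (p v)"
    using verts by (metis UN_E)
  have "proper_colouring H m (\<lambda>v. c (p v) v)"
    unfolding proper_colouring_def
  proof (intro conjI ballI impI)
    fix v assume "v \<in> verts H"
    with p have "p v \<in> I" "v \<in> V (p v)" by auto
    then show "c (p v) v < m"
      using c(1) assms by (meson order_less_le_trans)
  next
    fix u v assume uv: "u \<in> verts H" "v \<in> verts H" "adjacent H u v"
    with p have "p u \<in> I" "u \<in> V (p u)" "p v \<in> I" "v \<in> V (p v)"
      by auto
    moreover from this have "v \<in> V (p u)"
      using adjacent_same_part uv(3) by blast
    ultimately have "v \<in> V (p u)" "p u = p v"
      using part_unique by auto
    then show "c (p u) u \<noteq> c (p v) v"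
      using c(2)[of "p u" u v] uv p[OF uv(1)] by (simp add: adjacent_induced)
  qed
  then show ?thesis
    by (rule chromatic_number_le)
qed

lemma clique_number_le_parts:
  assumes "\<And>i. i \<in> I \<Longrightarrow> clique_number (part i) \<le> m"
  shows "clique_number H \<le> m"
proof -
  obtain K where K: "clique H K" "card K = clique_number H"
    using clique_number_attained[OF simple] .
  show ?thesis
  proof (cases "K = {}")
    case False
    then obtain i where i: "i \<in> I" "K \<subseteq> V i"
      using clique_in_part K(1) by blast
    then have "clique (part i) K"
      using K(1) by (auto simp: clique_def adjacent_induced)
    then show ?thesis
      using clique_number_ge[OF simple_part[OF i(1)]] assms[OF i(1)] K(2) by fastforce
  qed (use K(2) in simp)
qed

text \<open>An independent set meets each part in an independent set, and independent sets of
  different parts have no edge between them, so their union is independent.\<close>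

lemma independence_number_parts: "independence_number H = (\<Sum>i\<in>I. independence_number (part i))"
proof (rule antisym)
  obtain K where K: "independent H K" "card K = independence_number H"
    using independence_number_attained[OF simple] .
  have "independent (part i) (K \<inter> V i)" if "i \<in> I" for i
    using K(1) by (auto simp: independent_def adjacent_induced)
  then have "(\<Sum>i\<in>I. card (K \<inter> V i)) \<le> (\<Sum>i\<in>I. independence_number (part i))"
    using independence_number_ge simple_part by (intro sum_mono) blast
  moreover have "K = (\<Union>i\<in>I. K \<inter> V i)"
    using K(1) verts by (auto simp: independent_def)
  then have "card K \<le> (\<Sum>i\<in>I. card (K \<inter> V i))"
    using card_UN_le[OF finite_index, of "\<lambda>i. K \<inter> V i"] by simp
  ultimately show "independence_number H \<le> (\<Sum>i\<in>I. independence_number (part i))"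
    using K(2) by simp
next
  have "\<exists>K. independent (part i) K \<and> card K = independence_number (part i)" if "i \<in> I" for i
    using independence_number_attained[OF simple_part[OF that]] by blast
  then obtain K where K: "\<And>i. i \<in> I \<Longrightarrow> independent (part i) (K i)"
    "\<And>i. i \<in> I \<Longrightarrow> card (K i) = independence_number (part i)"
    by metis
  have sub: "K i \<subseteq> V i" if "i \<in> I" for i
    using K(1)[OF that] by (simp add: independent_def)
  have "finite (K i)" if "i \<in> I" for i
    using sub[OF that] part_subset[OF that] finite_verts[OF simple] by (meson finite_subset)
  moreover have "K i \<inter> K j = {}" if "i \<in> I" "j \<in> I" "i \<noteq> j" for i j
    using sub that part_unique by blast
  ultimately have "card (\<Union>i\<in>I. K i) = (\<Sum>i\<in>I. card (K i))"
    using finite_index by (intro card_UN_disjoint) auto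
  moreover have "independent H (\<Union>i\<in>I. K i)"
    unfolding independent_def
  proof (intro conjI ballI notI)
    show "(\<Union>i\<in>I. K i) \<subseteq> verts H"
      using sub part_subset by blast
    fix u v assume "u \<in> (\<Union>i\<in>I. K i)" "v \<in> (\<Union>i\<in>I. K i)" and uv: "adjacent H u v"
    then obtain i j where ij: "i \<in> I" "u \<in> K i" "j \<in> I" "v \<in> K j" by blast
    then have "v \<in> V i" "i = j"
      using adjacent_same_part[OF uv, of i] sub part_unique[of i j v] by blast+
    with ij sub have "u \<in> K i" "v \<in> K i" "adjacent (part i) u v"
      using uv by (auto simp: adjacent_induced)
    then show False
      using K(1)[OF ij(1)] by (auto simp: independent_def)
  qed
  ultimately show "(\<Sum>i\<in>I. independence_number (part i)) \<le> independence_number H"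
    using independence_number_ge[OF simple] K(2) by fastforce
qed

text \<open>Covers of the parts unite to a cover of the whole. Conversely a cover splits, since each
  of its nonempty cliques lies in exactly one part.\<close>

lemma clique_cover_number_parts: "clique_cover_number H = (\<Sum>i\<in>I. clique_cover_number (part i))"
proof (rule antisym)
  have "\<exists>P. partition_on (V i) P \<and> (\<forall>K\<in>P. clique (part i) K) \<and> card P = clique_cover_number (part i)" for i
    using clique_cover_attained[of "part i"] by (metis verts_induced)
  then obtain P where P: "\<And>i. partition_on (V i) (P i)" "\<And>i K. K \<in> P i \<Longrightarrow> clique (part i) K"
    "\<And>i. card (P i) = clique_cover_number (part i)"
    by metis
  have "partition_on (verts H) (\<Union>i\<in>I. P i)"
    unfolding partition_on_def disjoint_def
  proof (intro conjI ballI impI)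
    show "\<Union> (\<Union>i\<in>I. P i) = verts H" "{} \<notin> (\<Union>i\<in>I. P i)"
      using P(1) unfolding partition_on_def verts by blast+
    fix K L assume "K \<in> (\<Union>i\<in>I. P i)" "L \<in> (\<Union>i\<in>I. P i)" "K \<noteq> L"
    then obtain i j where ij: "i \<in> I" "K \<in> P i" "j \<in> I" "L \<in> P j" by blast
    then have "K \<subseteq> V i" "L \<subseteq> V j"
      using P(1) by (auto simp: partition_on_def)
    show "K \<inter> L = {}"
    proof (cases "i = j")
      case True
      then show ?thesis
        using ij P(1)[of i] \<open>K \<noteq> L\<close> by (auto simp: partition_on_def disjoint_def)
    next
      case False
      then show ?thesis
        using ij part_unique \<open>K \<subseteq> V i\<close> \<open>L \<subseteq> V j\<close> by blast
    qed
  qed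
  moreover have "clique H K" if "K \<in> (\<Union>i\<in>I. P i)" for K
    using that P(2) part_subset by (fastforce simp: clique_def adjacent_induced)
  ultimately have "clique_cover_number H \<le> card (\<Union>i\<in>I. P i)"
    by (rule clique_cover_number_le)
  also have "\<dots> \<le> (\<Sum>i\<in>I. card (P i))"
    by (rule card_UN_le[OF finite_index])
  finally show "clique_cover_number H \<le> (\<Sum>i\<in>I. clique_cover_number (part i))"
    by (simp add: P(3))
next
  obtain P where P: "partition_on (verts H) P" "\<And>K. K \<in> P \<Longrightarrow> clique H K"
    "card P = clique_cover_number H"
    using clique_cover_attained by blast
  have ne: "K \<noteq> {}" if "K \<in> P" for K
    using P(1) that by (auto simp: partition_on_def)
  \<comment> \<open>\<open>Q i\<close> collects the cliques of the optimal cover that lie in part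
    \<open>i\<close>; these families are disjoint and each covers its part.\<close>
  define Q where "Q i = {K \<in> P. K \<subseteq> V i}" for i
  have "finite P"
    using P(1) finite_verts[OF simple] finite_elements by blast
  then have fin: "finite (Q i)" for i
    by (simp add: Q_def)
  have "clique_cover_number (part i) \<le> card (Q i)" if i: "i \<in> I" for i
  proof (rule clique_cover_number_le)
    have "\<exists>K\<in>Q i. v \<in> K" if v: "v \<in> V i" for v
    proof -
      obtain K where K: "K \<in> P" "v \<in> K"
        using P(1) v part_subset[OF i] by (auto simp: partition_on_def)
      then obtain j where "j \<in> I" "K \<subseteq> V j"
        using clique_in_part[OF P(2)[OF K(1)] ne[OF K(1)]] by blast
      with part_unique[OF i, of j v] v K show ?thesis by (auto simp: Q_def)
    qed
    then show "partition_on (verts (part i)) (Q i)"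
      using P(1) by (auto simp: partition_on_def Q_def disjoint_def)
    show "clique (part i) K" if "K \<in> Q i" for K
      using that P(2) by (auto simp: Q_def clique_def adjacent_induced subset_iff)
  qed
  then have "(\<Sum>i\<in>I. clique_cover_number (part i)) \<le> (\<Sum>i\<in>I. card (Q i))"
    by (rule sum_mono)
  also have "\<dots> = card (\<Union>i\<in>I. Q i)"
  proof (rule card_UN_disjoint[symmetric, OF finite_index])
    show "\<forall>i\<in>I. \<forall>j\<in>I. i \<noteq> j \<longrightarrow> Q i \<inter> Q j = {}"
    proof (intro ballI impI equals0I)
      fix i j K assume ij: "i \<in> I" "j \<in> I" "i \<noteq> j" and "K \<in> Q i \<inter> Q j"
      then have "K \<in> P" "K \<subseteq> V i" "K \<subseteq> V j" by (auto simp: Q_def)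
      with ne ij part_unique show False by blast
    qed
  qed (use fin in simp)
  also have "\<dots> \<le> card P"
    using \<open>finite P\<close> by (intro card_mono) (auto simp: Q_def)
  finally show "(\<Sum>i\<in>I. clique_cover_number (part i)) \<le> clique_cover_number H"
    by (simp add: P(3))
qed

end

section \<open>Components and the selections on them\<close>

lemma reachable_sym: "reachable G u v \<Longrightarrow> reachable G v u"
  unfolding reachable_def
  by (rule sympD[OF symp_rtranclp]) (auto simp: symp_def adjacent_commute[of G])

lemma component_induced: "C \<in> components G \<Longrightarrow> C = induced_subgraph G (verts C)"
  by (auto simp: components_def)

text \<open>Reachability is an equivalence, so any vertex of a component can serve as its root. Two
  components with a common vertex therefore coincide.\<close>

lemma component_eq:
  assumes "C \<in> components G" "v \<in> verts C"
  shows "C = induced_subgraph G {u \<in> verts G. reachable G v u}"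
proof -
  obtain w where w: "C = induced_subgraph G {u \<in> verts G. reachable G w u}"
    using assms(1) by (auto simp: components_def)
  then have "reachable G w v"
    using assms(2) by simp
  then have "reachable G w u \<longleftrightarrow> reachable G v u" for u
    using reachable_sym[of G w v] unfolding reachable_def by (meson rtranclp_trans)
  then show ?thesis
    using w by simp
qed

lemma split_graph_components:
  assumes "simple_graph G"
  shows "split_graph G (components G) verts"
proof
  show "finite (components G)"
    using finite_verts[OF assms] by (simp add: components_def)
  show "disjoint_family_on verts (components G)"
    unfolding disjoint_family_on_def
  proof (intro ballI impI equals0I)
    fix C D v assume "C \<in> components G" "D \<in> components G" "C \<noteq> D" "v \<in> verts C \<inter> verts D"
    then show False
      using component_eq[of C G v] component_eq[of D G v] by simp
  qed
  show "verts G = (\<Union>C\<in>components G. verts C)"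
    by (auto simp: components_def reachable_def)
  fix e assume "e \<in> edges G"
  then obtain u v where e: "e = {u, v}" "adjacent G u v"
    using edge_adjacentE[OF assms] by metis
  then show "\<exists>C\<in>components G. e \<subseteq> verts C"
    using adjacent_verts[OF assms e(2)] by (auto simp: components_def reachable_def)
qed (rule assms)

lemma one_removed_cong: "(\<And>v. v \<in> verts G \<Longrightarrow> f v = g v) \<Longrightarrow> one_removed G f = one_removed G g"
  by (simp add: one_removed_def)

context
  fixes G :: "'a graph"
  assumes G: "simple_graph G"
begin

interpretation split_graph G "components G" verts
  by (rule split_graph_components[OF G])

lemma simple_component: "C \<in> components G \<Longrightarrow> simple_graph C"
  using simple_part component_induced by metis

lemma subgraph_component:
  assumes "C \<in> components G" shows "subgraph C G"
proof -
  have "edges C = {e \<in> edges G. e \<subseteq> verts C}"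
    using arg_cong[OF component_induced[OF assms], of edges] by simp
  then show ?thesis
    using part_subset[OF assms] by (auto simp: subgraph_def)
qed

text \<open>Unlike for general subgraphs, \<open>f\<close> needs no truncation: a nonempty
  \<open>f v\<close> contains \<open>v\<close> and lies in one component, which must be that of
  \<open>v\<close>.\<close>

lemma one_selection_component:
  assumes f: "one_selection G f" and C: "C \<in> components G"
  shows "one_selection C f"
  unfolding one_selection_def
proof (intro ballI conjI impI)
  fix v assume v: "v \<in> verts C"
  with part_subset[OF C] have vG: "v \<in> verts G" by blast
  show "v \<in> f v" if "f v \<noteq> {}"
    using f vG that by (simp add: one_selection_def)
  show "f v \<in> edges C \<union> {{}}"
  proof (cases "f v = {}")
    case False
    with f vG have fv: "f v \<in> edges G" "v \<in> f v" by (auto simp: one_selection_def)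
    with edge_part obtain D where D: "D \<in> components G" "f v \<subseteq> verts D" by blast
    with part_unique[OF C D(1) v] fv have "f v \<subseteq> verts C" by blast
    with fv(1) have "f v \<in> edges (induced_subgraph G (verts C))" by simp
    then show ?thesis using component_induced[OF C] by simp
  qed simp
qed

lemma one_removed_component:
  assumes f: "one_selection G f" and C: "C \<in> components G"
  shows "one_removed C f = induced_subgraph (one_removed G f) (verts C)"
proof (rule graph.expand, intro conjI)
  \<comment> \<open>An edge inside \<open>C\<close> can only be selected by one of its ends, so the
    vertices outside \<open>C\<close> remove nothing from it.\<close>
  have "v \<in> verts C" if "f v \<in> edges G" "f v \<subseteq> verts C" "v \<in> verts G" for v
    using f that card_edge[OF G that(1)] by (auto simp: one_selection_def)
  then show "edges (one_removed C f) = edges (induced_subgraph (one_removed G f) (verts C))"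
    using arg_cong[OF component_induced[OF C], of edges] part_subset[OF C] by auto
qed simp

text \<open>Deleting edges creates no crossing edge, so the components of \<open>G\<close> still
  split the smaller graph.\<close>

lemma split_graph_one_removed: "split_graph (one_removed G f) (components G) verts"
  using simple_graph_one_removed[OF G] finite_index disjoint verts edge_part
  by unfold_locales auto

text \<open>Each vertex follows the selection of its own component. Since components select
  independently, all of them can be optimal at the same time.\<close>

lemma one_selection_combine:
  assumes g: "\<And>C. C \<in> components G \<Longrightarrow> one_selection C (g C)"
  obtains f where "one_selection G f"
    "\<And>C. C \<in> components G \<Longrightarrow> one_removed C (g C) = induced_subgraph (one_removed G f) (verts C)"
proof -
  obtain p where p: "\<And>v. v \<in> verts G \<Longrightarrow> p v \<in> components G \<and> v \<in> verts (p v)"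
    using verts by (metis UN_E)
  define f where "f v = g (p v) v" for v
  have "f v \<in> edges G \<union> {{}} \<and> (f v \<noteq> {} \<longrightarrow> v \<in> f v)" if "v \<in> verts G" for v
    using g[of "p v"] p[OF that] subgraph_component[of "p v"]
    by (auto simp: one_selection_def subgraph_def f_def)
  then have f: "one_selection G f"
    by (simp add: one_selection_def)
  have "one_removed C (g C) = induced_subgraph (one_removed G f) (verts C)" if C: "C \<in> components G" for C
  proof -
    have "p v = C" if "v \<in> verts C" for v
      using part_unique[OF _ C _ that] p part_subset[OF C] that by blast
    then show ?thesis
      using one_removed_component[OF f C] one_removed_cong[of C "g C" f] by (simp add: f_def)
  qed
  with f show thesis
    using that by blast
qed

text \<open>A vertex is required because \<open>Max\<close> of the empty set has no useful
  value.\<close>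

lemma chi1_components:
  assumes "verts G \<noteq> {}"
  shows "chi1 G = Max (chi1 ` components G)"
proof (rule antisym)
  have "\<exists>f. one_selection C f \<and> chi1 C = chromatic_number (one_removed C f)" if "C \<in> components G" for C
    using chi1_attained[OF simple_component[OF that]] by blast
  then obtain g where g: "\<And>C. C \<in> components G \<Longrightarrow> one_selection C (g C)"
    "\<And>C. C \<in> components G \<Longrightarrow> chi1 C = chromatic_number (one_removed C (g C))"
    by metis
  obtain f where f: "one_selection G f"
    "\<And>C. C \<in> components G \<Longrightarrow> one_removed C (g C) = induced_subgraph (one_removed G f) (verts C)"
    using one_selection_combine[of g] g(1) by blast
  have "chromatic_number (one_removed G f) \<le> Max (chi1 ` components G)"
    using f(2) g(2) finite_index
    by (intro split_graph.chromatic_number_le_parts[OF split_graph_one_removed]) (metis Max_ge finite_imageI imageI)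
  then show "chi1 G \<le> Max (chi1 ` components G)"
    using chi1_le[OF G f(1)] by simp
  \<comment> \<open>Components are subgraphs, so monotonicity gives this direction.\<close>
  show "Max (chi1 ` components G) \<le> chi1 G"
    using assms finite_index chi1_mono[OF G simple_component subgraph_component]
    by (subst Max_le_iff) (auto simp: components_def)
qed

lemma omega1_components:
  assumes "verts G \<noteq> {}"
  shows "omega1 G = Max (omega1 ` components G)"
proof (rule antisym)
  have "\<exists>f. one_selection C f \<and> omega1 C = clique_number (one_removed C f)" if "C \<in> components G" for C
    using omega1_attained[OF simple_component[OF that]] by blast
  then obtain g where g: "\<And>C. C \<in> components G \<Longrightarrow> one_selection C (g C)"
    "\<And>C. C \<in> components G \<Longrightarrow> omega1 C = clique_number (one_removed C (g C))"
    by metis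
  obtain f where f: "one_selection G f"
    "\<And>C. C \<in> components G \<Longrightarrow> one_removed C (g C) = induced_subgraph (one_removed G f) (verts C)"
    using one_selection_combine[of g] g(1) by blast
  have "clique_number (one_removed G f) \<le> Max (omega1 ` components G)"
    using f(2) g(2) finite_index
    by (intro split_graph.clique_number_le_parts[OF split_graph_one_removed]) (metis Max_ge finite_imageI imageI)
  then show "omega1 G \<le> Max (omega1 ` components G)"
    using omega1_le[OF G f(1)] by simp
  show "Max (omega1 ` components G) \<le> omega1 G"
    using assms finite_index omega1_mono[OF G simple_component subgraph_component]
    by (subst Max_le_iff) (auto simp: components_def)
qed

text \<open>Monotonicity does not help, as components need not be spanning. Instead the additivity
  of the independence number is used twice: for an optimal selection of \<open>G\<close> read on
  each component, and for the combination of optimal selections of the components.\<close>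

lemma alpha1_components: "alpha1 G = (\<Sum>C\<in>components G. alpha1 C)"
proof (rule antisym)
  obtain f where f: "one_selection G f" "alpha1 G = independence_number (one_removed G f)"
    using alpha1_attained[OF G] .
  have "alpha1 G = (\<Sum>C\<in>components G. independence_number (one_removed C f))"
    using split_graph.independence_number_parts[OF split_graph_one_removed, of f]
    by (simp add: f one_removed_component)
  also have "\<dots> \<le> (\<Sum>C\<in>components G. alpha1 C)"
    by (intro sum_mono alpha1_ge simple_component one_selection_component[OF f(1)])
  finally show "alpha1 G \<le> (\<Sum>C\<in>components G. alpha1 C)" .
next
  have "\<exists>f. one_selection C f \<and> alpha1 C = independence_number (one_removed C f)"
    if "C \<in> components G" for C
    using alpha1_attained[OF simple_component[OF that]] by blast
  then obtain g where g: "\<And>C. C \<in> components G \<Longrightarrow> one_selection C (g C)"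
    "\<And>C. C \<in> components G \<Longrightarrow> alpha1 C = independence_number (one_removed C (g C))"
    by metis
  obtain f where f: "one_selection G f"
    "\<And>C. C \<in> components G \<Longrightarrow> one_removed C (g C) = induced_subgraph (one_removed G f) (verts C)"
    using one_selection_combine[of g] g(1) by blast
  have "(\<Sum>C\<in>components G. alpha1 C) = independence_number (one_removed G f)"
    using split_graph.independence_number_parts[OF split_graph_one_removed, of f] f(2) g(2) by simp
  then show "(\<Sum>C\<in>components G. alpha1 C) \<le> alpha1 G"
    using alpha1_ge[OF G f(1)] by simp
qed

lemma theta1_components: "theta1 G = (\<Sum>C\<in>components G. theta1 C)"
proof (rule antisym)
  obtain f where f: "one_selection G f" "theta1 G = clique_cover_number (one_removed G f)"
    using theta1_attained[OF G] .
  have "theta1 G = (\<Sum>C\<in>components G. clique_cover_number (one_removed C f))"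
    using split_graph.clique_cover_number_parts[OF split_graph_one_removed, of f]
    by (simp add: f one_removed_component)
  also have "\<dots> \<le> (\<Sum>C\<in>components G. theta1 C)"
    by (intro sum_mono theta1_ge simple_component one_selection_component[OF f(1)])
  finally show "theta1 G \<le> (\<Sum>C\<in>components G. theta1 C)" .
next
  have "\<exists>f. one_selection C f \<and> theta1 C = clique_cover_number (one_removed C f)"
    if "C \<in> components G" for C
    using theta1_attained[OF simple_component[OF that]] by blast
  then obtain g where g: "\<And>C. C \<in> components G \<Longrightarrow> one_selection C (g C)"
    "\<And>C. C \<in> components G \<Longrightarrow> theta1 C = clique_cover_number (one_removed C (g C))"
    by metis
  obtain f where f: "one_selection G f"
    "\<And>C. C \<in> components G \<Longrightarrow> one_removed C (g C) = induced_subgraph (one_removed G f) (verts C)"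
    using one_selection_combine[of g] g(1) by blast
  have "(\<Sum>C\<in>components G. theta1 C) = clique_cover_number (one_removed G f)"
    using split_graph.clique_cover_number_parts[OF split_graph_one_removed, of f] f(2) g(2) by simp
  then show "(\<Sum>C\<in>components G. theta1 C) \<le> theta1 G"
    using theta1_ge[OF G f(1)] by simp
qed

end

section \<open>Unions and products\<close>

lemma simple_graph_union: "simple_graph G \<Longrightarrow> simple_graph H \<Longrightarrow> simple_graph (graph_union G H)"
  by (auto simp: simple_graph_def graph_union_def)

lemma graph_union_commute: "graph_union G H = graph_union H G"
  by (simp add: graph_union_def Un_commute)

text \<open>An optimal selection of \<open>H\<close> is also a selection of the union. Every edge
  left over belongs to \<open>G\<close> or survives in \<open>H\<close>, so a pair of colours, one
  for all of \<open>G\<close> and one for the remainder of \<open>H\<close>, separates its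
  ends.\<close>

lemma chi1_graph_union:
  assumes G: "simple_graph G" and H: "simple_graph H" and V: "verts G = verts H"
  shows "chi1 (graph_union G H) \<le> chromatic_number G * chi1 H"
proof -
  obtain f where f: "one_selection H f" "chi1 H = chromatic_number (one_removed H f)"
    using chi1_attained[OF H] .
  obtain a where a: "\<And>v. v \<in> verts G \<Longrightarrow> a v < chromatic_number G"
    "\<And>u v. adjacent G u v \<Longrightarrow> a u \<noteq> a v"
    using chromatic_number_colouring[OF G] by blast
  obtain b where b: "\<And>v. v \<in> verts H \<Longrightarrow> b v < chi1 H"
    "\<And>u v. adjacent (one_removed H f) u v \<Longrightarrow> b u \<noteq> b v"
    using chromatic_number_colouring[OF simple_graph_one_removed[OF H, of f]] f(2) by auto
  have "one_selection (graph_union G H) f"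
    using f(1) V by (auto simp: one_selection_def graph_union_def)
  then have "chi1 (graph_union G H) \<le> chromatic_number (one_removed (graph_union G H) f)"
    by (rule chi1_le[OF simple_graph_union[OF G H]])
  also have "\<dots> \<le> card ({..<chromatic_number G} \<times> {..<chi1 H})"
  proof (rule chromatic_number_le_card[where c = "\<lambda>v. (a v, b v)"])
    fix u v assume "adjacent (one_removed (graph_union G H) f) u v"
    then have "adjacent G u v \<or> adjacent (one_removed H f) u v"
      using V by (auto simp: adjacent_def graph_union_def)
    then show "(a u, b u) \<noteq> (a v, b v)"
      using a(2) b(2) by blast
  qed (use a(1) b(1) V in \<open>auto simp: graph_union_def\<close>)
  finally show ?thesis
    by simp
qed

section \<open>Lexicographic products\<close>

lemma lex_product_adjacent:
  "adjacent (lex_product G H) (g, h) (g', h') \<longleftrightarrow>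
     g \<in> verts G \<and> g' \<in> verts G \<and> h \<in> verts H \<and> h' \<in> verts H \<and>
     (adjacent G g g' \<or> g = g' \<and> adjacent H h h')"
  unfolding lex_product_def adjacent_def
  by (simp add: doubleton_eq_iff) (auto simp: insert_commute)

lemma simple_graph_lex_product:
  assumes "simple_graph G" "simple_graph H"
  shows "simple_graph (lex_product G H)"
proof -
  have "finite (verts G \<times> verts H)"
    using assms by (simp add: finite_verts)
  moreover have "card {(g, h), (g', h')} = 2" if "adjacent G g g' \<or> g = g' \<and> adjacent H h h'" for g h g' h'
    using that adjacent_irrefl[OF assms(1)] adjacent_irrefl[OF assms(2)]
    by (subst card_2_iff') auto
  ultimately show ?thesis
    by (fastforce simp: simple_graph_def lex_product_def)
qed

lemma chi1_lex_product:
  assumes G: "simple_graph G" and H: "simple_graph H"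
  shows "chi1 (lex_product G H) \<le> chromatic_number G * chi1 H"
proof -
  let ?L = "lex_product G H"
  have verts: "verts ?L = verts G \<times> verts H"
    by (simp add: lex_product_def)
  obtain f where f: "one_selection H f" "chi1 H = chromatic_number (one_removed H f)"
    using chi1_attained[OF H] .
  obtain a where a: "\<And>v. v \<in> verts G \<Longrightarrow> a v < chromatic_number G"
    "\<And>u v. adjacent G u v \<Longrightarrow> a u \<noteq> a v"
    using chromatic_number_colouring[OF G] by blast
  obtain b where b: "\<And>v. v \<in> verts H \<Longrightarrow> b v < chi1 H"
    "\<And>u v. adjacent (one_removed H f) u v \<Longrightarrow> b u \<noteq> b v"
    using chromatic_number_colouring[OF simple_graph_one_removed[OF H, of f]] f(2) by auto
  \<comment> \<open>The selection of \<open>H\<close> is copied into each fibre over a vertex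
    \<open>g\<close>. Edges between different fibres are never selected; the colouring of
    \<open>G\<close> takes care of them.\<close>
  define F :: "'a \<times> 'b \<Rightarrow> ('a \<times> 'b) set" where "F = (\<lambda>(g, h). Pair g ` f h)"
  have "F (g, h) \<in> edges ?L \<union> {{}} \<and> (F (g, h) \<noteq> {} \<longrightarrow> (g, h) \<in> F (g, h))"
    if gh: "g \<in> verts G" "h \<in> verts H" for g h
  proof (cases "f h = {}")
    case False
    with gh f(1) have e: "f h \<in> edges H" "h \<in> f h"
      by (auto simp: one_selection_def)
    obtain x y where xy: "f h = {x, y}" "adjacent H x y"
      using edge_adjacentE[OF H e(1)] .
    then have "adjacent ?L (g, x) (g, y)"
      using gh(1) adjacent_verts[OF H] by (auto simp: lex_product_adjacent)
    then show ?thesis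
      using xy(1) e(2) by (auto simp: F_def adjacent_def)
  qed (simp add: F_def)
  then have "one_selection ?L F"
    by (auto simp: one_selection_def verts)
  then have "chi1 ?L \<le> chromatic_number (one_removed ?L F)"
    by (rule chi1_le[OF simple_graph_lex_product[OF G H]])
  also have "\<dots> \<le> card ({..<chromatic_number G} \<times> {..<chi1 H})"
  proof (rule chromatic_number_le_card[where c = "\<lambda>(g, h). (a g, b h)"])
    fix p q assume pq: "adjacent (one_removed ?L F) p q"
    obtain g h g' h' where p: "p = (g, h)" and q: "q = (g', h')"
      by fastforce
    have adj: "adjacent ?L (g, h) (g', h')" and F: "{(g, h), (g', h')} \<notin> F ` (verts G \<times> verts H)"
      using pq by (auto simp: p q adjacent_def verts)
    show "(case p of (g, h) \<Rightarrow> (a g, b h)) \<noteq> (case q of (g, h) \<Rightarrow> (a g, b h))"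
    proof (cases "adjacent G g g'")
      case True
      then show ?thesis using a(2) p q by auto
    next
      case False
      with adj have g: "g = g'" "g \<in> verts G" and h: "adjacent H h h'"
        by (auto simp: lex_product_adjacent)
      \<comment> \<open>If \<open>w\<close> selected this edge in \<open>H\<close>, its copy
        \<open>(g, w)\<close> would have removed the edge of the fibre.\<close>
      have "{h, h'} \<noteq> f w" if "w \<in> verts H" for w
      proof
        assume "{h, h'} = f w"
        then have "{(g, h), (g', h')} = F (g, w)"
          using g(1) unfolding F_def by (simp flip: \<open>{h, h'} = f w\<close>)
        then show False using F g(2) that by blast
      qed
      then have "adjacent (one_removed H f) h h'"
        using h by (auto simp: adjacent_def)
      then show ?thesis using b(2) p q by auto
    qed
  qed (use a(1) b(1) in \<open>auto simp: verts\<close>)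
  finally show ?thesis
    by simp
qed

section \<open>Unions of many graphs\<close>

text \<open>Every nonempty \<open>S\<close> contains a vertex with at most \<open>2 * k\<close>
  neighbours in \<open>S\<close>. It is set aside, the rest is coloured by induction, and one of
  \<open>2 * k + 1\<close> colours is free for it.\<close>

lemma chromatic_number_le_density:
  assumes G: "simple_graph G"
    and dens: "\<And>S. S \<subseteq> verts G \<Longrightarrow> card {e \<in> edges G. e \<subseteq> S} \<le> k * card S"
  shows "chromatic_number G \<le> 2 * k + 1"
proof -
  have "S \<subseteq> verts G \<Longrightarrow>
      \<exists>c. (\<forall>v\<in>S. c v < 2 * k + 1) \<and> (\<forall>u\<in>S. \<forall>v\<in>S. adjacent G u v \<longrightarrow> c u \<noteq> c v)" for S
  proof (induction "card S" arbitrary: S)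
    case 0
    then have "S = {}"
      using finite_verts[OF G] finite_subset by fastforce
    then show ?case by simp
  next
    case (Suc n)
    have finS: "finite S"
      using Suc.hyps(2) by (metis Zero_not_Suc card.infinite)
    define E where "E = {e \<in> edges G. e \<subseteq> S}"
    have finE: "finite E"
      using finite_edges[OF G] by (simp add: E_def)
    \<comment> \<open>Double counting: each edge inside \<open>S\<close> is counted at both of its
      ends.\<close>
    have "(\<Sum>v\<in>S. card {e \<in> E. v \<in> e}) = 2 * card E"
    proof (rule sum_multicount[OF finS finE], rule ballI)
      fix e assume e: "e \<in> E"
      then have "{v \<in> S. v \<in> e} = e" by (auto simp: E_def)
      then show "card {v \<in> S. v \<in> e} = 2"
        using e card_edge[OF G] by (simp add: E_def)
    qed
    also have "\<dots> \<le> 2 * (k * card S)"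
      using dens[OF Suc.prems] by (simp add: E_def)
    \<comment> \<open>Strict because \<open>S\<close> is nonempty; hence not all degrees inside
      \<open>S\<close> can reach \<open>2 * k + 1\<close>.\<close>
    also have "\<dots> < (\<Sum>v\<in>S. 2 * k + 1)"
      using Suc.hyps(2) by (simp add: algebra_simps)
    finally obtain v where v: "v \<in> S" "card {e \<in> E. v \<in> e} \<le> 2 * k"
      by (metis (no_types, lifting) Suc_eq_plus1 leI le_simps(3) not_less sum_mono)
    have "n = card (S - {v})"
      using Suc.hyps(2) v(1) finS by simp
    moreover have "S - {v} \<subseteq> verts G"
      using Suc.prems by blast
    ultimately have "\<exists>c. (\<forall>w\<in>S - {v}. c w < 2 * k + 1) \<and>
        (\<forall>u\<in>S - {v}. \<forall>w\<in>S - {v}. adjacent G u w \<longrightarrow> c u \<noteq> c w)"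
      by (rule Suc.hyps(1))
    then obtain c where c: "\<And>w. w \<in> S - {v} \<Longrightarrow> c w < 2 * k + 1"
      "\<And>u w. u \<in> S - {v} \<Longrightarrow> w \<in> S - {v} \<Longrightarrow> adjacent G u w \<Longrightarrow> c u \<noteq> c w"
      by metis
    define N where "N = {w \<in> S. adjacent G w v}"
    have "card N \<le> card {e \<in> E. v \<in> e}"
    proof (rule card_inj_on_le[where f = "\<lambda>w. {w, v}"])
      show "inj_on (\<lambda>w. {w, v}) N"
        by (auto simp: inj_on_def doubleton_eq_iff)
      show "finite {e \<in> E. v \<in> e}"
        using finE by simp
    qed (use v(1) in \<open>auto simp: N_def E_def adjacent_def\<close>)
    then have "card (c ` N) < 2 * k + 1"
      using v(2) card_image_le[of N c] finS by (simp add: N_def)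
    \<comment> \<open>The neighbours block at most \<open>2 * k\<close> colours.\<close>
    then have "\<not> {..<2 * k + 1} \<subseteq> c ` N"
      using card_mono[of "c ` N" "{..<2 * k + 1}"] finS by (auto simp: N_def)
    then obtain x where x: "x < 2 * k + 1" "x \<notin> c ` N"
      by blast
    show ?case
    proof (intro exI conjI ballI impI)
      fix u w assume uw: "u \<in> S" "w \<in> S" "adjacent G u w"
      then have "w = v \<Longrightarrow> u \<in> N" "u = v \<Longrightarrow> w \<in> N" "u \<noteq> w"
        using adjacent_commute[of G] adjacent_irrefl[OF G] by (auto simp: N_def)
      then show "(c(v := x)) u \<noteq> (c(v := x)) w"
        using x(2) c(2) uw by auto
    qed (use x(1) c(1) in auto)
  qed
  from this[OF subset_refl] obtain c where "proper_colouring G (2 * k + 1) c"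
    unfolding proper_colouring_def by blast
  then show ?thesis
    by (rule chromatic_number_le)
qed

lemma chi1_graph_Union:
  assumes k: "k \<ge> 1" and G: "\<And>i. i \<in> {1..k} \<Longrightarrow> simple_graph (G i) \<and> verts (G i) = V"
  shows "chi1 (graph_Union {1..k} G) \<le> (2 * k + 1) * (\<Prod>i\<in>{1..k}. chi1 (G i))"
proof -
  let ?U = "graph_Union {1..k} G"
  have V: "verts ?U = V"
    using k G by (auto simp: graph_Union_def)
  have U: "simple_graph ?U"
    unfolding simple_graph_def V
  proof (intro conjI ballI)
    show "finite V"
      using G[of 1] k finite_verts by fastforce
    fix e assume "e \<in> edges ?U"
    then obtain i where "i \<in> {1..k}" "e \<in> edges (G i)"
      by (auto simp: graph_Union_def)
    then show "e \<subseteq> V" "card e = 2"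
      using G edge_subset_verts card_edge by metis+
  qed
  have "\<exists>f. one_selection (G i) f \<and> chi1 (G i) = chromatic_number (one_removed (G i) f)"
    if "i \<in> {1..k}" for i
    using chi1_attained[of "G i"] G[OF that] by blast
  then obtain f where f: "\<And>i. i \<in> {1..k} \<Longrightarrow> one_selection (G i) (f i)"
    "\<And>i. i \<in> {1..k} \<Longrightarrow> chi1 (G i) = chromatic_number (one_removed (G i) (f i))"
    by metis
  have "\<exists>c. (\<forall>v\<in>V. c v < chi1 (G i)) \<and> (\<forall>u v. adjacent (one_removed (G i) (f i)) u v \<longrightarrow> c u \<noteq> c v)"
    if "i \<in> {1..k}" for i
    using chromatic_number_colouring[OF simple_graph_one_removed[of "G i" "f i"]] G[OF that] f(2)[OF that]
    by (metis verts_one_removed)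
  then obtain c where c: "\<And>i v. i \<in> {1..k} \<Longrightarrow> v \<in> V \<Longrightarrow> c i v < chi1 (G i)"
    "\<And>i u v. i \<in> {1..k} \<Longrightarrow> adjacent (one_removed (G i) (f i)) u v \<Longrightarrow> c i u \<noteq> c i v"
    by metis
  \<comment> \<open>\<open>R\<close> gathers the edges of the union that some optimal selection
    removes from its own graph.\<close>
  define R where "R = Graph V (edges ?U \<inter> (\<Union>i\<in>{1..k}. f i ` V))"
  have R: "simple_graph R"
    using U V by (auto simp: simple_graph_def R_def)
  have "chromatic_number R \<le> 2 * k + 1"
  proof (rule chromatic_number_le_density[OF R])
    fix S assume "S \<subseteq> verts R"
    then have finS: "finite S"
      using finite_verts[OF R] finite_subset by blast
    \<comment> \<open>The selecting vertex lies on the edge, so an edge inside \<open>S\<close> is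
      selected by a vertex of \<open>S\<close>, in one of \<open>k\<close> graphs.\<close>
    have "{e \<in> edges R. e \<subseteq> S} \<subseteq> (\<lambda>(i, v). f i v) ` ({1..k} \<times> S)"
    proof
      fix e assume "e \<in> {e \<in> edges R. e \<subseteq> S}"
      then have e: "e \<subseteq> S" "e \<in> edges R" by auto
      then obtain i v where i: "i \<in> {1..k}" "v \<in> V" "e = f i v"
        unfolding R_def by auto
      have "f i v \<noteq> {}"
        using card_edge[OF R e(2)] i(3) by auto
      then have "v \<in> e"
        using f(1)[OF i(1)] i G by (auto simp: one_selection_def)
      then show "e \<in> (\<lambda>(i, v). f i v) ` ({1..k} \<times> S)"
        using i e by auto
    qed
    then have "card {e \<in> edges R. e \<subseteq> S} \<le> card ({1..k} \<times> S)"
      using finS by (intro surj_card_le) auto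
    then show "card {e \<in> edges R. e \<subseteq> S} \<le> k * card S"
      by (simp add: card_cartesian_product)
  qed
  moreover obtain r where r: "\<And>v. v \<in> V \<Longrightarrow> r v < chromatic_number R"
    "\<And>u v. adjacent R u v \<Longrightarrow> r u \<noteq> r v"
    using chromatic_number_colouring[OF R] by (auto simp: R_def)
  ultimately have r_less: "r v < 2 * k + 1" if "v \<in> V" for v
    using that by force
  \<comment> \<open>The empty selection is enough: the edges that the individual selections removed
    are handled by the factor \<open>2 * k + 1\<close>.\<close>
  have "chi1 ?U \<le> chromatic_number (one_removed ?U (\<lambda>_. {}))"
    by (rule chi1_le[OF U one_selection_empty])
  also have "\<dots> \<le> card ({..<2 * k + 1} \<times> (PiE {1..k} (\<lambda>i. {..<chi1 (G i)})))"
  proof (rule chromatic_number_le_card[where c = "\<lambda>v. (r v, restrict (\<lambda>i. c i v) {1..k})"])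
    fix u v assume "adjacent (one_removed ?U (\<lambda>_. {})) u v"
    then obtain i where i: "i \<in> {1..k}" "adjacent (G i) u v" "adjacent ?U u v"
      by (auto simp: adjacent_def graph_Union_def)
    \<comment> \<open>An edge of \<open>G i\<close> is either selected by \<open>f i\<close>, and
      then the first coordinate separates its ends, or it survives, and then coordinate
      \<open>i\<close> of the tuple does.\<close>
    have "adjacent R u v \<or> adjacent (one_removed (G i) (f i)) u v"
    proof (cases "{u, v} \<in> f i ` V")
      case True
      with i have "adjacent R u v"
        unfolding adjacent_def R_def by (simp only: graph.sel) blast
      then show ?thesis ..
    qed (use i G in \<open>simp add: adjacent_def\<close>)
    then show "(r u, restrict (\<lambda>i. c i u) {1..k}) \<noteq> (r v, restrict (\<lambda>i. c i v) {1..k})"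
      using r(2) c(2)[OF i(1)] i(1) by (metis Pair_inject restrict_apply')
  qed (use r_less c(1) V in \<open>auto intro: finite_PiE\<close>)
  finally show ?thesis
    by (simp add: card_cartesian_product card_PiE)
qed

section \<open>Complete graphs and circulants\<close>

text \<open>All \<open>s choose 2\<close> edges inside a colour class of size \<open>s\<close> are selected by its own \<open>s\<close> vertices,
  hence \<open>s \<le> 3\<close>.\<close>

lemma card_le_chi1_complete:
  assumes G: "simple_graph G" and complete: "\<And>u v. u \<in> verts G \<Longrightarrow> v \<in> verts G \<Longrightarrow> u \<noteq> v \<Longrightarrow> adjacent G u v"
  shows "card (verts G) \<le> 3 * chi1 G"
proof -
  obtain f where f: "one_selection G f" "chi1 G = chromatic_number (one_removed G f)"
    using chi1_attained[OF G] .
  obtain c where c: "\<And>v. v \<in> verts G \<Longrightarrow> c v < chi1 G"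
    "\<And>u v. adjacent (one_removed G f) u v \<Longrightarrow> c u \<noteq> c v"
    using chromatic_number_colouring[OF simple_graph_one_removed[OF G, of f]] f(2) by auto
  define S where "S j = {v \<in> verts G. c v = j}" for j
  have finS: "finite (S j)" for j
    using finite_verts[OF G] by (simp add: S_def)
  have "card (S j) \<le> 3" for j
  proof -
    have "{e. e \<subseteq> S j \<and> card e = 2} \<subseteq> f ` S j"
    proof
      fix e assume "e \<in> {e. e \<subseteq> S j \<and> card e = 2}"
      then obtain u v where e: "e = {u, v}" "u \<noteq> v" "u \<in> S j" "v \<in> S j"
        by (auto simp: card_2_iff)
      then have "e \<in> edges G" "\<not> adjacent (one_removed G f) u v"
        using complete c(2)[of u v] by (auto simp: adjacent_def S_def)
      then obtain w where w: "w \<in> verts G" "e = f w"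
        using e(1) by (auto simp: adjacent_def)
      then have "w \<in> e"
        using f(1) e(1) by (auto simp: one_selection_def)
      then show "e \<in> f ` S j"
        using e w by auto
    qed
    then have "card {e. e \<subseteq> S j \<and> card e = 2} \<le> card (S j)"
      using finS by (rule surj_card_le[rotated])
    then have "card (S j) * (card (S j) - 1) div 2 \<le> card (S j)"
      using n_subsets[OF finS, of j 2] by (simp add: choose_two del: One_nat_def)
    \<comment> \<open>Parity makes the division by 2 exact, so that the bound can be multiplied
      out.\<close>
    moreover have "even (card (S j) * (card (S j) - 1))"
      by (cases "card (S j)") auto
    ultimately have "card (S j) * (card (S j) - 1) \<le> card (S j) * 2"
      by (elim evenE) simp
    then show ?thesis
      by (cases "card (S j) = 0") auto
  qed
  moreover have "verts G = (\<Union>j<chi1 G. S j)"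
    using c(1) by (auto simp: S_def)
  ultimately show ?thesis
    using card_UN_le[of "{..<chi1 G}" S] sum_mono[of "{..<chi1 G}" "\<lambda>j. card (S j)" "\<lambda>_. 3"]
    by simp
qed

lemma mod_add_neq_self: "0 < i \<Longrightarrow> i < n \<Longrightarrow> v < n \<Longrightarrow> (v + i) mod n \<noteq> (v :: nat)"
  by (auto simp: mod_if)

lemma chi1_graph_Union_tight:
  assumes "k \<ge> 1"
  shows "\<exists>(V :: nat set) (G :: nat \<Rightarrow> nat graph). V \<noteq> {} \<and>
            (\<forall>i\<in>{1..k}. simple_graph (G i) \<and> verts (G i) = V) \<and>
            real (chi1 (graph_Union {1..k} G))
              \<ge> (2 * real k + 1) / 3 * (\<Prod>i\<in>{1..k}. real (chi1 (G i)))"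
proof -
  \<comment> \<open>On a cycle of this odd length any two vertices are at distance at most
    \<open>k\<close>.\<close>
  define n where "n = 2 * k + 1"
  \<comment> \<open>\<open>f i\<close> has two roles: its values are the edges of the circulant with
    step \<open>i\<close>, and it is the selection that removes them all.\<close>
  define f where "f i v = {v, (v + i) mod n}" for i v
  define G where "G i = Graph {..<n} (f i ` {..<n})" for i
  have simple: "simple_graph (G i)" if "i \<in> {1..k}" for i
    unfolding simple_graph_def
  proof (intro conjI ballI)
    fix e assume "e \<in> edges (G i)"
    then obtain v where "v < n" "e = f i v"
      by (auto simp: G_def)
    moreover from this have "(v + i) mod n \<noteq> v"
      using that by (intro mod_add_neq_self) (auto simp: n_def)
    ultimately show "e \<subseteq> verts (G i)" "card e = 2"
      by (auto simp: G_def f_def card_2_iff')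
  qed (simp add: G_def)
  have verts: "verts (G i) = {..<n}" for i
    by (simp add: G_def)
  have "chi1 (G i) \<le> 1" if i: "i \<in> {1..k}" for i
  proof -
    have "chi1 (G i) \<le> chromatic_number (one_removed (G i) (f i))"
      by (rule chi1_le[OF simple[OF i]]) (auto simp: one_selection_def G_def f_def)
    also have "\<dots> \<le> 1"
      by (rule chromatic_number_le[of _ _ "\<lambda>_. 0"]) (simp add: proper_colouring_def adjacent_def G_def)
    finally show ?thesis .
  qed
  \<comment> \<open>An upper bound suffices, since the product stands on the smaller side of the
    claim.\<close>
  then have prod: "(\<Prod>i\<in>{1..k}. real (chi1 (G i))) \<le> 1"
    by (intro prod_le_1) auto
  let ?U = "graph_Union {1..k} G"
  have vU: "verts ?U = {..<n}"
    using assms by (auto simp: graph_Union_def verts)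
  have U: "simple_graph ?U"
    using simple vU unfolding simple_graph_def by (auto simp: graph_Union_def verts)
  have adjI: "adjacent ?U u v" if "{u, v} = f i w" "i \<in> {1..k}" "w < n" for u v i w
    using that unfolding adjacent_def graph_Union_def G_def by auto
  \<comment> \<open>Of the two arcs between \<open>u\<close> and \<open>v\<close>, with lengths
    \<open>v - u\<close> and \<open>n - (v - u)\<close>, one is at most \<open>k\<close>; in the
    second case the step starts at \<open>v\<close> and wraps around.\<close>
  have adj: "adjacent ?U u v" if "u < v" "v < n" for u v
  proof (cases "v - u \<le> k")
    case True
    with that have "{u, v} = f (v - u) u" by (simp add: f_def)
    then show ?thesis
      using that True by (intro adjI[of u v "v - u" u]) auto
  next
    case False
    with that have "(v + (n - (v - u))) mod n = u" "n - (v - u) \<in> {1..k}"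
      by (auto simp: mod_if n_def)
    moreover from this have "{u, v} = f (n - (v - u)) v" by (auto simp: f_def)
    ultimately show ?thesis
      using that(2) adjI by blast
  qed
  have "adjacent ?U u v" if "u < n" "v < n" "u \<noteq> v" for u v
    using that adj[of u v] adj[of v u] adjacent_commute[of ?U] by (metis linorder_neqE_nat)
  then have "card {..<n} \<le> 3 * chi1 ?U"
    using card_le_chi1_complete[OF U] vU by simp
  then have "(2 * real k + 1) / 3 \<le> real (chi1 ?U)"
    by (simp add: n_def)
  moreover have "(2 * real k + 1) / 3 * (\<Prod>i\<in>{1..k}. real (chi1 (G i))) \<le> (2 * real k + 1) / 3"
    using prod by (simp add: mult_left_le)
  ultimately have "(2 * real k + 1) / 3 * (\<Prod>i\<in>{1..k}. real (chi1 (G i))) \<le> real (chi1 ?U)"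
    by linarith
  then show ?thesis
    using simple verts by (intro exI[of _ "{..<n}"] exI[of _ G]) (auto simp: n_def lessThan_empty_iff simp del: One_nat_def)
qed

text \<open>A single vertex without edges, taken as both graphs, makes all the numbers involved
  equal to 1.\<close>

lemma chi1_graph_union_tight:
  "\<exists>G1 G2 :: nat graph. simple_graph G1 \<and> simple_graph G2 \<and>
     verts G1 = verts G2 \<and> verts G1 \<noteq> {} \<and>
     chi1 (graph_union G1 G2) = min (chromatic_number G1 * chi1 G2) (chi1 G1 * chromatic_number G2)"
proof -
  let ?G = "Graph {0 :: nat} {}"
  have G: "simple_graph ?G"
    by (simp add: simple_graph_def)
  have "chromatic_number ?G \<le> 1"
    by (rule chromatic_number_le[of _ _ "\<lambda>_. 0"]) (simp add: proper_colouring_def adjacent_def)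
  moreover have "chromatic_number ?G > 0"
    by (rule chromatic_number_colouring[OF G]) force
  ultimately have chi: "chromatic_number ?G = 1"
    by simp
  obtain f where "chi1 ?G = chromatic_number (one_removed ?G f)"
    using chi1_attained[OF G] .
  then have "chi1 ?G = 1"
    using chi by (simp add: one_removed_def)
  with G chi show ?thesis
    by (intro exI[of _ ?G]) (simp add: graph_union_def)
qed

text \<open>The witness is a single edge, which one vertex can select for removal; its line graph
  still has a vertex to be coloured.\<close>

lemma chi_index1_line_graph: "\<exists>G :: nat graph. simple_graph G \<and> chi_index1 G \<noteq> chi1 (line_graph G)"
proof -
  let ?G = "Graph {0 :: nat, 1} {{0, 1}}"
  let ?f = "\<lambda>v :: nat. {0, 1 :: nat}"
  have G: "simple_graph ?G"
    by (simp add: simple_graph_def)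
  have "one_selection ?G ?f"
    by (simp add: one_selection_def)
  then have "chi_index1 ?G \<le> chromatic_index (one_removed ?G ?f)"
    unfolding chi_index1_def by (intro Min_le[OF finite_one_removed[OF G]]) blast
  \<comment> \<open>Without edges, an edge colouring needs no colour at all.\<close>
  also have "\<dots> \<le> 0"
    unfolding chromatic_index_def
    by (rule Least_le) (intro exI[of _ "\<lambda>_. 0"], simp add: proper_edge_colouring_def)
  finally have index: "chi_index1 ?G = 0"
    by simp
  have L: "simple_graph (line_graph ?G)"
    by (simp add: simple_graph_def line_graph_def)
  obtain f where f: "chi1 (line_graph ?G) = chromatic_number (one_removed (line_graph ?G) f)"
    using chi1_attained[OF L] .
  have "{0, 1} \<in> verts (one_removed (line_graph ?G) f)"
    by (simp add: line_graph_def)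
  then have "chi1 (line_graph ?G) > 0"
    using chromatic_number_colouring[OF simple_graph_one_removed[OF L, of f]] f
    by (metis gr0I not_less_zero)
  with G index show ?thesis
    by (intro exI[of _ ?G]) simp
qed

theorem theorem5:
  shows
   "(\<forall>G H :: 'a graph. simple_graph G \<and> simple_graph H \<longrightarrow>
       (spanning_subgraph H G \<longrightarrow> alpha1 G \<le> alpha1 H \<and> theta1 G \<le> theta1 H) \<and>
       (subgraph H G \<longrightarrow> omega1 G \<ge> omega1 H \<and> chi1 G \<ge> chi1 H))
  \<and> (\<forall>G :: 'a graph. simple_graph G \<and> \<not> connected_graph G \<longrightarrow>
       chi1 G = Max (chi1 ` components G) \<and>
       omega1 G = Max (omega1 ` components G) \<and>
       alpha1 G = (\<Sum>C\<in>components G. alpha1 C) \<and>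
       theta1 G = (\<Sum>C\<in>components G. theta1 C))
  \<and> ((\<forall>G1 G2 :: 'a graph. simple_graph G1 \<and> simple_graph G2 \<and> verts G1 = verts G2 \<longrightarrow>
         chi1 (graph_union G1 G2)
           \<le> min (chromatic_number G1 * chi1 G2) (chi1 G1 * chromatic_number G2)) \<and>
      (\<exists>G1 G2 :: nat graph. simple_graph G1 \<and> simple_graph G2 \<and>
         verts G1 = verts G2 \<and> verts G1 \<noteq> {} \<and>
         chi1 (graph_union G1 G2)
           = min (chromatic_number G1 * chi1 G2) (chi1 G1 * chromatic_number G2)))
  \<and> ((\<forall>(k :: nat) (V :: 'a set) (G :: nat \<Rightarrow> 'a graph). k \<ge> 1 \<and>
         (\<forall>i\<in>{1..k}. simple_graph (G i) \<and> verts (G i) = V) \<longrightarrow>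
         chi1 (graph_Union {1..k} G) \<le> (2 * k + 1) * (\<Prod>i\<in>{1..k}. chi1 (G i))) \<and>
      (\<forall>k :: nat. k \<ge> 1 \<longrightarrow>
         (\<exists>(V :: nat set) (G :: nat \<Rightarrow> nat graph). V \<noteq> {} \<and>
            (\<forall>i\<in>{1..k}. simple_graph (G i) \<and> verts (G i) = V) \<and>
            real (chi1 (graph_Union {1..k} G))
              \<ge> (2 * real k + 1) / 3 * (\<Prod>i\<in>{1..k}. real (chi1 (G i))))))
  \<and> (\<forall>(G :: 'a graph) (H :: 'b graph). simple_graph G \<and> simple_graph H \<longrightarrow>
       chi1 (lex_product G H) \<le> chromatic_number G * chi1 H)
  \<and> (\<exists>G :: nat graph. simple_graph G \<and> chi_index1 G \<noteq> chi1 (line_graph G))"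
proof (intro conjI allI impI)
  fix G H :: "'a graph"
  assume GH: "simple_graph G \<and> simple_graph H"
  show "alpha1 G \<le> alpha1 H" "theta1 G \<le> theta1 H" if "spanning_subgraph H G"
    using alpha1_antimono theta1_antimono GH that by blast+
  show "omega1 G \<ge> omega1 H" "chi1 G \<ge> chi1 H" if "subgraph H G"
    using omega1_mono chi1_mono GH that by blast+
next
  fix G :: "'a graph"
  assume G: "simple_graph G \<and> \<not> connected_graph G"
  \<comment> \<open>The graph without vertices counts as connected, so a disconnected graph has a
    component and the maxima are meaningful.\<close>
  then have "verts G \<noteq> {}"
    by (auto simp: connected_graph_def)
  with G show "chi1 G = Max (chi1 ` components G)" "omega1 G = Max (omega1 ` components G)"
    "alpha1 G = (\<Sum>C\<in>components G. alpha1 C)" "theta1 G = (\<Sum>C\<in>components G. theta1 C)"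
    using chi1_components omega1_components alpha1_components theta1_components by blast+
next
  fix G1 G2 :: "'a graph"
  assume "simple_graph G1 \<and> simple_graph G2 \<and> verts G1 = verts G2"
  then show "chi1 (graph_union G1 G2)
      \<le> min (chromatic_number G1 * chi1 G2) (chi1 G1 * chromatic_number G2)"
    using chi1_graph_union[of G1 G2] chi1_graph_union[of G2 G1]
    by (simp add: graph_union_commute[of G2] mult.commute)
next
  fix k :: nat and V :: "'a set" and G :: "nat \<Rightarrow> 'a graph"
  assume "k \<ge> 1 \<and> (\<forall>i\<in>{1..k}. simple_graph (G i) \<and> verts (G i) = V)"
  then show "chi1 (graph_Union {1..k} G) \<le> (2 * k + 1) * (\<Prod>i\<in>{1..k}. chi1 (G i))"
    using chi1_graph_Union[of k G V] by blast
next
  fix G :: "'a graph" and H :: "'b graph"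
  assume "simple_graph G \<and> simple_graph H"
  then show "chi1 (lex_product G H) \<le> chromatic_number G * chi1 H"
    using chi1_lex_product by blast
qed (fact chi1_graph_union_tight chi1_graph_Union_tight chi_index1_line_graph)+

end
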